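(* Let $S\subseteq\mathbb{R}^n$ be nonempty and closed, let $I=\{1,\dots,m\}$, let $\beta\ge 0$, and let $O\subseteq\mathbb{R}^n$ be an open set containing $S$. Suppose that for each $i\in I$, on $O$, $f_i\colon\mathbb{R}^n\to(-\infty,+\infty]$ is locally Lipschitz, $g_i\colon\mathbb{R}^n\to(-\infty,+\infty]$ is continuously differentiable, and $h_i\colon\mathbb{R}^n\to\mathbb{R}$ is $\beta$-weakly convex. Put $F_i:=f_i+g_i-h_i$ and consider the multiobjective problem $\min_{x\in S}(F_1(x),\dots,F_m(x))$. If $\bar x\in S$ is a local weak Pareto solution of this problem, then $\bar x$ is a stationary point of it, i.e. there exists $\lambda=(\lambda_1,\dots,\lambda_m)\in\mathbb{R}^m_+\setminus\{0\}$ such that $$0\in\sum_{i\in I}\lambda_i\left(\partial f_i(\bar x)+\nabla g_i(\bar x)-\partial h_i(\bar x)\right)+N_S(\bar x).$$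
   Context: $\mathbb{R}^n$ carries the usual inner product and Euclidean norm; $\mathbb{R}^m_+$ is the nonnegative orthant; sums and differences of sets are Minkowski. Normal cones: for $x\in S$, the regular (Fréchet) normal cone is $\widehat N_S(x)=\{v:\limsup_{y\to x,\,y\in S,\,y\ne x}\langle v,y-x\rangle/\|y-x\|\le 0\}$, and the limiting (Mordukhovich) normal cone $N_S(x)$ is the set of $v$ for which there are $x_k\to x$ with $x_k\in S$ and $v_k\to v$ with $v_k\in\widehat N_S(x_k)$. Subdifferential: for $\varphi\colon\mathbb{R}^n\to(-\infty,+\infty]$ and $x$ with $\varphi(x)<+\infty$, the limiting (Mordukhovich) subdifferential is $\partial\varphi(x)=\{v:(v,-1)\in N_{\operatorname{epi}\varphi}(x,\varphi(x))\}$, where $\operatorname{epi}\varphi=\{(x,\alpha)\in\mathbb{R}^n\times\mathbb{R}:\alpha\ge\varphi(x)\}$. $\varphi$ is locally Lipschitz on an open set if every point of the set has a neighborhood on which $\varphi$ is finite and Lipschitz. $\varphi$ is $\beta$-weakly convex on a set $O$ if $\beta\ge0$ and $\varphi+\delta_O+\frac{\beta}{2}\|\cdot\|^2$ is convex, where $\delta_O$ is $0$ on $O$ and $+\infty$ elsewhere. $\bar x\in S$ is a local weak Pareto solution if there is a neighborhood $U$ of $\bar x$ such that no $x\in S\cap U$ satisfies $F_i(x)<F_i(\bar x)$ for all $i\in I$. *)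

theory Defs
  imports "HOL-Analysis.Analysis"
begin

text \<open>Extended-real-valued functions into $(-\infty,+\infty]$ are modelled as functions into
  \<^typ>\<open>ereal\<close>, with the exclusion of $-\infty$ stated as a hypothesis where it is needed. Normal
  cones are only meant to be used at points of the set. At an isolated point of \<open>S\<close> the \<open>Limsup\<close>
  is over the trivial filter, hence $-\infty$, and the regular normal cone is the whole space.\<close>

definition regular_normal_cone :: "'a::real_inner set \<Rightarrow> 'a \<Rightarrow> 'a set" where
  "regular_normal_cone S x =
     {v. Limsup (at x within S) (\<lambda>y. ereal (inner v (y - x) / norm (y - x))) \<le> 0}"

definition limiting_normal_cone :: "'a::real_inner set \<Rightarrow> 'a \<Rightarrow> 'a set" where
  "limiting_normal_cone S x =
     {v. \<exists>X V. (\<forall>k::nat. X k \<in> S \<and> V k \<in> regular_normal_cone S (X k)) \<and>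
               X \<longlonglongrightarrow> x \<and> V \<longlonglongrightarrow> v}"

text \<open>The library's \<open>epigraph\<close> is restricted to real-valued functions.\<close>

definition epi :: "('a \<Rightarrow> ereal) \<Rightarrow> ('a \<times> real) set" where
  "epi \<phi> = {(x, \<alpha>). \<phi> x \<le> ereal \<alpha>}"

text \<open>Only meaningful at points where \<open>\<phi>\<close> is finite.\<close>

definition limiting_subdifferential :: "('a::real_inner \<Rightarrow> ereal) \<Rightarrow> 'a \<Rightarrow> 'a set" where
  "limiting_subdifferential \<phi> x =
     {v. (v, -1) \<in> limiting_normal_cone (epi \<phi>) (x, real_of_ereal (\<phi> x))}"

definition locally_Lipschitz_on :: "'a::metric_space set \<Rightarrow> ('a \<Rightarrow> ereal) \<Rightarrow> bool" where
  "locally_Lipschitz_on \<Omega> \<phi> \<longleftrightarrow>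
     (\<forall>x\<in>\<Omega>. \<exists>U L. open U \<and> x \<in> U \<and> (\<forall>y\<in>U. \<bar>\<phi> y\<bar> \<noteq> \<infinity>) \<and>
        L-lipschitz_on U (\<lambda>y. real_of_ereal (\<phi> y)))"

text \<open>Only meaningful where \<open>\<phi>\<close> is finite near \<open>x\<close> and differentiable at \<open>x\<close>; the gradient is
  then unique.\<close>

definition gradient :: "('a::real_inner \<Rightarrow> ereal) \<Rightarrow> 'a \<Rightarrow> 'a" where
  "gradient \<phi> x = (THE D. GDERIV (\<lambda>y. real_of_ereal (\<phi> y)) x :> D)"

text \<open>Intended for open \<open>\<Omega>\<close>: differentiability is not relativised to \<open>\<Omega>\<close>.\<close>

definition continuously_differentiable_on :: "'a::real_inner set \<Rightarrow> ('a \<Rightarrow> ereal) \<Rightarrow> bool" where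
  "continuously_differentiable_on \<Omega> \<phi> \<longleftrightarrow>
     (\<forall>x\<in>\<Omega>. \<bar>\<phi> x\<bar> \<noteq> \<infinity> \<and> GDERIV (\<lambda>y. real_of_ereal (\<phi> y)) x :> gradient \<phi> x) \<and>
     continuous_on \<Omega> (gradient \<phi>)"

text \<open>Convexity of an extended-real-valued function is convexity of its epigraph.\<close>

definition weakly_convex_on :: "real \<Rightarrow> 'a::real_inner set \<Rightarrow> ('a \<Rightarrow> ereal) \<Rightarrow> bool" where
  "weakly_convex_on \<beta> \<Omega> \<phi> \<longleftrightarrow> 0 \<le> \<beta> \<and>
     convex (epi (\<lambda>x. \<phi> x + (if x \<in> \<Omega> then 0 else \<infinity>) + ereal (\<beta> / 2 * (norm x)\<^sup>2)))"

definition local_weak_Pareto ::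
  "'i set \<Rightarrow> 'a::topological_space set \<Rightarrow> ('i \<Rightarrow> 'a \<Rightarrow> ereal) \<Rightarrow> 'a \<Rightarrow> bool" where
  "local_weak_Pareto I S F xbar \<longleftrightarrow> xbar \<in> S \<and>
     (\<exists>U. open U \<and> xbar \<in> U \<and> \<not> (\<exists>x\<in>S \<inter> U. \<forall>i\<in>I. F i x < F i xbar))"

text \<open>On sets, \<open>-\<close> is set-theoretic difference in HOL, so the Minkowski difference needs its own
  name; \<open>+\<close> and \<open>\<Sum>\<close> on sets are the Minkowski ones from \<^theory>\<open>HOL-Library.Set_Algebras\<close>.\<close>

definition minkowski_diff :: "'a::minus set \<Rightarrow> 'a set \<Rightarrow> 'a set" where
  "minkowski_diff A B = {a - b |a b. a \<in> A \<and> b \<in> B}"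

text \<open>For tuples indexed by \<open>{1..m}\<close> only the entries with index in \<open>{1..m}\<close> matter.\<close>

definition stationary_point ::
  "nat \<Rightarrow> 'a::real_inner set \<Rightarrow> (nat \<Rightarrow> 'a \<Rightarrow> ereal) \<Rightarrow> (nat \<Rightarrow> 'a \<Rightarrow> ereal) \<Rightarrow>
   (nat \<Rightarrow> 'a \<Rightarrow> real) \<Rightarrow> 'a \<Rightarrow> bool" where
  "stationary_point m S f g h x \<longleftrightarrow>
     (\<exists>l::nat \<Rightarrow> real. (\<forall>i\<in>{1..m}. 0 \<le> l i) \<and> (\<exists>i\<in>{1..m}. l i \<noteq> 0) \<and>
        0 \<in> (\<Sum>i\<in>{1..m}. (*\<^sub>R) (l i) `
                (minkowski_diff (limiting_subdifferential (f i) x + {gradient (g i) x})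
                                (limiting_subdifferential (\<lambda>y. ereal (h i y)) x)))
             + limiting_normal_cone S x)"

end

theory Submission
  imports Defs
begin

text \<open>Every weakly convex \<open>h\<^sub>i\<close> is supported from below at \<open>xbar\<close> by a concave quadratic
  with some slope \<open>w\<^sub>i\<close>, and this slope belongs to the limiting subdifferential of
  \<open>h\<^sub>i\<close> at \<open>xbar\<close>. Replacing \<open>h\<^sub>i\<close> by the quadratic decreases no objective and
  changes no objective value at \<open>xbar\<close>, so \<open>xbar\<close> remains a local weak Pareto solution, now for
  objectives \<open>f\<^sub>i + q\<^sub>i\<close> with \<open>q\<^sub>i\<close> continuously differentiable and
  \<open>\<nabla>q\<^sub>i(xbar) = \<nabla>g\<^sub>i(xbar) - w\<^sub>i\<close>. It remains to find multipliers for such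
  objectives.

  The usual route, a maximum rule followed by a sum rule for limiting subdifferentials, is replaced
  by a single penalization that does the work of both. Give every \<open>f\<^sub>i\<close> a variable
  \<open>y\<^sub>i\<close> of its own, put \<open>c\<^sub>i = f\<^sub>i(xbar) + q\<^sub>i(xbar)\<close>, and for large
  \<open>k\<close> minimize
  \<open>\<Psi>(y, s) = \<Sum>\<^sub>i (exp (k (f\<^sub>i(y\<^sub>i) + q\<^sub>i(s) - c\<^sub>i)) + k\<^sup>2 |y\<^sub>i - s|\<^sup>2) + k |s - xbar|\<^sup>2\<close>
  over \<open>s \<in> S\<close> near \<open>xbar\<close> and \<open>y\<^sub>i\<close> near \<open>xbar\<close>. The sum of exponentials is a
  smooth stand-in for the maximum. Since its derivatives are positive, minimality in
  \<open>y\<^sub>i\<close> makes \<open>f\<^sub>i\<close> lie above a smooth function touching it at \<open>y\<^sub>i\<close>,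
  which yields a regular subgradient \<open>v\<^sub>i\<close>; and minimality in \<open>s\<close>, which only occurs in smooth
  terms, yields a regular normal of \<open>S\<close> at \<open>s\<close>. The gradients of the terms
  \<open>|y\<^sub>i - s|\<^sup>2\<close> in \<open>y\<^sub>i\<close> and in \<open>s\<close> are opposite, so after division by
  \<open>k\<close> times the sum \<open>E\<close> of the exponentials these conditions combine to
  \<open>\<nu> + \<Sum>\<^sub>i \<lambda>\<^sub>i (v\<^sub>i + \<nabla>q\<^sub>i(s)) = -(2 / E) (s - xbar)\<close>, where \<open>\<nu>\<close> is
  a regular normal of \<open>S\<close> at \<open>s\<close> and \<open>\<lambda>\<^sub>i\<close> is the \<open>i\<close>-th exponential
  divided by \<open>E\<close>.

  Two estimates finish the argument. Comparing with the value \<open>m\<close> of \<open>\<Psi>\<close> when all variables equal \<open>xbar\<close> gives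
  \<open>k |s - xbar|\<^sup>2 \<le> m\<close> and \<open>k |y\<^sub>i - s| \<le> sqrt m\<close>. At \<open>s\<close> some objective is
  at least \<open>c\<^sub>i\<close>, by weak Pareto optimality, so a common Lipschitz constant \<open>L\<close> of the \<open>f\<^sub>i\<close> gives
  \<open>E \<ge> exp (-L sqrt m)\<close>, a bound independent of \<open>k\<close>. Hence the right-hand side above tends to
  \<open>0\<close>: this is \<open>fuzzy_multiplier_rule\<close>. The \<open>\<lambda>\<^sub>i\<close> lie in \<open>[0, 1]\<close> and add up to
  \<open>1\<close>, the \<open>v\<^sub>i\<close> are bounded by \<open>L\<close>, and a limit along a subsequence gives
  \<open>limiting_multiplier_rule\<close>.\<close>

section \<open>Regular normals and regular subgradients\<close>

text \<open>A form without quotients, in which the base point and isolated points of the set need no special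
  treatment.\<close>

lemma mem_regular_normal_cone_iff:
  "v \<in> regular_normal_cone S x \<longleftrightarrow>
     (\<forall>\<epsilon>>0. \<forall>\<^sub>F y in at x within S. inner v (y - x) \<le> \<epsilon> * norm (y - x))"
    (is "?L \<longleftrightarrow> ?R")
proof
  assume ?L
  then have L: "\<forall>C>0. \<forall>\<^sub>F y in at x within S. ereal (inner v (y - x) / norm (y - x)) < C"
    by (simp add: regular_normal_cone_def Limsup_le_iff)
  show ?R
  proof (intro allI impI)
    fix \<epsilon> :: real assume "\<epsilon> > 0"
    then have "\<forall>\<^sub>F y in at x within S. ereal (inner v (y - x) / norm (y - x)) < ereal \<epsilon>"
      using L[rule_format, of "ereal \<epsilon>"] by simp
    moreover have "\<forall>\<^sub>F y in at x within S. y \<noteq> x"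
      by (auto simp: eventually_at_filter)
    ultimately show "\<forall>\<^sub>F y in at x within S. inner v (y - x) \<le> \<epsilon> * norm (y - x)"
      by eventually_elim (simp add: divide_less_eq)
  qed
next
  assume R: ?R
  have "\<forall>\<^sub>F y in at x within S. ereal (inner v (y - x) / norm (y - x)) < C" if "C > 0" for C
  proof -
    obtain \<epsilon> where \<epsilon>: "\<epsilon> > 0" "ereal \<epsilon> < C"
      using \<open>C > 0\<close> ereal_dense2[of 0 C] by (auto simp: zero_ereal_def)
    have "\<forall>\<^sub>F y in at x within S. inner v (y - x) \<le> \<epsilon> * norm (y - x)"
      using R \<epsilon> by blast
    moreover have "\<forall>\<^sub>F y in at x within S. y \<noteq> x"
      by (auto simp: eventually_at_filter)
    ultimately show ?thesis
    proof eventually_elim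
      case (elim y)
      then have "inner v (y - x) / norm (y - x) \<le> \<epsilon>" by (simp add: divide_le_eq)
      then have "ereal (inner v (y - x) / norm (y - x)) \<le> ereal \<epsilon>" by simp
      then show ?case using \<epsilon>(2) by (rule le_less_trans)
    qed
  qed
  then show ?L
    by (simp add: regular_normal_cone_def Limsup_le_iff)
qed

lemma regular_normal_cone_scaleR:
  assumes "v \<in> regular_normal_cone S x" and "0 < c"
  shows "c *\<^sub>R v \<in> regular_normal_cone S x"
  unfolding mem_regular_normal_cone_iff
proof (intro allI impI)
  fix \<epsilon> :: real assume "\<epsilon> > 0"
  then have "\<forall>\<^sub>F y in at x within S. inner v (y - x) \<le> \<epsilon> / c * norm (y - x)"
    using assms unfolding mem_regular_normal_cone_iff by (meson divide_pos_pos)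
  then show "\<forall>\<^sub>F y in at x within S. inner (c *\<^sub>R v) (y - x) \<le> \<epsilon> * norm (y - x)"
    by eventually_elim (use \<open>0 < c\<close> in \<open>simp add: field_simps\<close>)
qed

lemma limiting_normal_coneI:
  assumes "\<And>k::nat. X k \<in> S" and "\<And>k. V k \<in> regular_normal_cone S (X k)"
    and "X \<longlonglongrightarrow> x" and "V \<longlonglongrightarrow> v"
  shows "v \<in> limiting_normal_cone S x"
  unfolding limiting_normal_cone_def using assms by (intro CollectI exI[of _ X] exI[of _ V]) auto

lemma GDERIV_eventually_close:
  assumes "GDERIV P x :> D" and "\<epsilon> > 0"
  shows "\<forall>\<^sub>F y in nhds x. \<bar>P y - P x - inner D (y - x)\<bar> \<le> \<epsilon> * norm (y - x)"
proof -
  obtain d where "d > 0"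
    and "\<And>y. norm (y - x) < d \<Longrightarrow> norm (P y - P x - inner (y - x) D) \<le> \<epsilon> * norm (y - x)"
    using assms unfolding gderiv_def has_derivative_at_alt by blast
  then show ?thesis
    unfolding eventually_nhds_metric by (auto simp: dist_norm inner_commute)
qed

text \<open>Fermat's rule for a smooth function constrained to a set.\<close>

lemma neg_gradient_mem_regular_normal_cone:
  assumes "GDERIV P x :> D" and "\<forall>\<^sub>F y in at x within S. P x \<le> P y"
  shows "- D \<in> regular_normal_cone S x"
  unfolding mem_regular_normal_cone_iff
proof (intro allI impI)
  fix \<epsilon> :: real assume "\<epsilon> > 0"
  have "\<forall>\<^sub>F y in at x within S. \<bar>P y - P x - inner D (y - x)\<bar> \<le> \<epsilon> * norm (y - x)"
    using GDERIV_eventually_close[OF assms(1) \<open>\<epsilon> > 0\<close>] by (auto simp: eventually_at_filter elim: eventually_mono)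
  with assms(2) show "\<forall>\<^sub>F y in at x within S. inner (- D) (y - x) \<le> \<epsilon> * norm (y - x)"
    by eventually_elim auto
qed

text \<open>This is the Frechet subgradient, for functions that are real-valued near the point.\<close>

definition regular_subgradient :: "('a::real_inner \<Rightarrow> real) \<Rightarrow> 'a \<Rightarrow> 'a \<Rightarrow> bool" where
  "regular_subgradient f x v \<longleftrightarrow>
     (\<forall>\<epsilon>>0. \<forall>\<^sub>F y in nhds x. f x + inner v (y - x) - \<epsilon> * norm (y - x) \<le> f y)"

lemma regular_subgradient_of_smooth_minorant:
  assumes "GDERIV \<psi> x :> v" and "\<psi> x = f x" and "\<forall>\<^sub>F y in nhds x. \<psi> y \<le> f y"
  shows "regular_subgradient f x v"
  unfolding regular_subgradient_def
proof (intro allI impI)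
  fix \<epsilon> :: real assume "\<epsilon> > 0"
  from GDERIV_eventually_close[OF assms(1) this] assms(3)
  show "\<forall>\<^sub>F y in nhds x. f x + inner v (y - x) - \<epsilon> * norm (y - x) \<le> f y"
    by eventually_elim (use assms(2) in auto)
qed

text \<open>Test the subgradient inequality in the direction of \<open>v\<close> itself. The bound supplies the
  compactness by which regular subgradients at nearby points have a limiting one as a cluster point.\<close>

lemma regular_subgradient_norm_le:
  assumes v: "regular_subgradient f x v" and U: "open U" "x \<in> U" and lip: "L-lipschitz_on U f"
  shows "norm v \<le> L"
proof (rule field_le_epsilon)
  fix \<epsilon> :: real assume "\<epsilon> > 0"
  have "\<forall>\<^sub>F y in nhds x. f x + inner v (y - x) - \<epsilon> * norm (y - x) \<le> f y"
    using v \<open>\<epsilon> > 0\<close> by (auto simp: regular_subgradient_def)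
  moreover have "\<forall>\<^sub>F y in nhds x. y \<in> U" using U by (auto simp: eventually_nhds)
  ultimately have "\<forall>\<^sub>F y in nhds x. inner v (y - x) \<le> (L + \<epsilon>) * norm (y - x)"
  proof eventually_elim
    case (elim y)
    have "f y - f x \<le> L * norm (y - x)"
      using lipschitz_onD[OF lip elim(2) U(2)] by (simp add: dist_norm)
    with elim show ?case by (simp add: algebra_simps)
  qed
  moreover have "((\<lambda>t. x + t *\<^sub>R v) \<longlongrightarrow> x + 0 *\<^sub>R v) (at_right 0)"
    by (intro tendsto_intros)
  ultimately have "\<forall>\<^sub>F t in at_right 0. inner v (t *\<^sub>R v) \<le> (L + \<epsilon>) * norm (t *\<^sub>R v)"
    by (auto simp: filterlim_iff dest!: spec)
  moreover have "\<forall>\<^sub>F t in at_right (0::real). t > 0" by (simp add: eventually_at_right_less)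
  ultimately have "\<forall>\<^sub>F t in at_right (0::real). inner v v \<le> (L + \<epsilon>) * norm v"
    by eventually_elim (auto simp: mult.left_commute)
  then have "inner v v \<le> (L + \<epsilon>) * norm v" by (simp add: eventually_const)
  then have "norm v * norm v \<le> (L + \<epsilon>) * norm v" by (simp add: dot_square_norm power2_eq_square)
  moreover have "0 \<le> L" using lip by (rule lipschitz_on_nonneg)
  ultimately show "norm v \<le> L + \<epsilon>"
    using \<open>\<epsilon> > 0\<close> by (cases "norm v = 0") (auto dest: mult_right_le_imp_le)
qed

text \<open>Near \<open>(x, f x)\<close> a point \<open>(y, \<alpha>)\<close> of the epigraph has \<open>\<alpha> \<ge> f y\<close>, so the
  subgradient inequality bounds \<open>inner v (y - x) - (\<alpha> - f x)\<close> by
  \<open>\<epsilon> * norm (y - x)\<close>.\<close>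

lemma regular_subgradient_imp_epi_normal:
  assumes v: "regular_subgradient f x v" and fin: "\<forall>\<^sub>F y in nhds x. \<phi> y = ereal (f y)"
  shows "(v, -1) \<in> regular_normal_cone (epi \<phi>) (x, f x)"
  unfolding mem_regular_normal_cone_iff
proof (intro allI impI)
  fix \<epsilon> :: real assume "\<epsilon> > 0"
  have "\<forall>\<^sub>F y in nhds x. \<phi> y = ereal (f y) \<and> f x + inner v (y - x) - \<epsilon> * norm (y - x) \<le> f y"
    using v \<open>\<epsilon> > 0\<close> fin by (auto simp: regular_subgradient_def intro: eventually_conj)
  moreover have "filterlim fst (nhds x) (at (x, f x) within epi \<phi>)"
    using tendsto_fst[OF tendsto_ident_at, of "(x, f x)" "epi \<phi>"] by simp
  ultimately have "\<forall>\<^sub>F p in at (x, f x) within epi \<phi>. \<phi> (fst p) = ereal (f (fst p)) \<and>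
      f x + inner v (fst p - x) - \<epsilon> * norm (fst p - x) \<le> f (fst p)"
    by (auto simp: filterlim_iff dest!: spec)
  moreover have "\<forall>\<^sub>F p in at (x, f x) within epi \<phi>. p \<in> epi \<phi>"
    by (auto simp: eventually_at_filter)
  ultimately show "\<forall>\<^sub>F p in at (x, f x) within epi \<phi>.
      inner (v, -1) (p - (x, f x)) \<le> \<epsilon> * norm (p - (x, f x))"
  proof eventually_elim
    case (elim p)
    obtain y \<alpha> where p: "p = (y, \<alpha>)" by force
    have "f y \<le> \<alpha>" using elim by (simp add: p epi_def)
    moreover have "norm (y - x) \<le> norm (p - (x, f x))"
      by (metis norm_fst_le p diff_Pair)
    then have "\<epsilon> * norm (y - x) \<le> \<epsilon> * norm (p - (x, f x))"
      using \<open>\<epsilon> > 0\<close> by simp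
    ultimately show ?case using elim by (simp add: p)
  qed
qed

lemma limiting_subdifferentialI:
  assumes Y: "Y \<longlonglongrightarrow> x" and fY: "(\<lambda>k. f (Y k)) \<longlonglongrightarrow> f x" and V: "V \<longlonglongrightarrow> v"
    and sub: "\<And>k::nat. regular_subgradient f (Y k) (V k)"
    and fin: "open U" "\<And>k. Y k \<in> U" "x \<in> U" "\<And>y. y \<in> U \<Longrightarrow> \<phi> y = ereal (f y)"
  shows "v \<in> limiting_subdifferential \<phi> x"
proof -
  have mem: "(Y k, f (Y k)) \<in> epi \<phi>" for k
    using fin by (simp add: epi_def)
  have normal: "(V k, -1) \<in> regular_normal_cone (epi \<phi>) (Y k, f (Y k))" for k
  proof -
    have "\<forall>\<^sub>F y in nhds (Y k). \<phi> y = ereal (f y)"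
      using eventually_nhds_in_open[OF fin(1) fin(2)[of k]] by eventually_elim (rule fin(4))
    then show ?thesis by (rule regular_subgradient_imp_epi_normal[OF sub])
  qed
  have "(\<lambda>k. (Y k, f (Y k))) \<longlonglongrightarrow> (x, f x)" "(\<lambda>k. (V k, - 1)) \<longlonglongrightarrow> (v, - 1)"
    by (intro tendsto_Pair Y fY V tendsto_const)+
  with mem normal have "(v, -1) \<in> limiting_normal_cone (epi \<phi>) (x, f x)"
    by (intro limiting_normal_coneI)
  then show ?thesis using fin by (simp add: limiting_subdifferential_def)
qed

section \<open>Gradients of penalty terms and compactness of products\<close>

lemma GDERIV_norm_diff_power2: "GDERIV (\<lambda>z. (norm (z - a))\<^sup>2) x :> 2 *\<^sub>R (x - a)"
  unfolding gderiv_def power2_norm_eq_inner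
  by (auto intro!: derivative_eq_intros simp: inner_commute fun_eq_iff algebra_simps)

lemma GDERIV_sum:
  assumes "\<And>i. i \<in> I \<Longrightarrow> GDERIV (P i) x :> D i"
  shows "GDERIV (\<lambda>x. \<Sum>i\<in>I. P i x) x :> (\<Sum>i\<in>I. D i)"
  using assms unfolding gderiv_def inner_sum_right by (intro has_derivative_sum)

lemma GDERIV_cmult: "GDERIV P x :> D \<Longrightarrow> GDERIV (\<lambda>x. c * P x) x :> c *\<^sub>R D"
  for c :: real
  unfolding gderiv_def by (auto intro!: derivative_eq_intros)

text \<open>Tychonoff's theorem in terms of the topology on the function type. It gives both the
  compactness of the domain of the penalized problem and a common convergent subsequence for a family
  of bounded sequences.\<close>

lemma compact_PiE_UNIV:
  fixes K :: "'i \<Rightarrow> 'b::topological_space set"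
  assumes "\<And>i. compact (K i)"
  shows "compact (PiE UNIV K)"
proof -
  have "compactin (product_topology (\<lambda>i. euclidean) UNIV) (PiE UNIV K)"
    using assms by (simp add: compactin_PiE)
  then show ?thesis by (simp add: euclidean_product_topology)
qed

section \<open>Supporting quadratics of weakly convex functions\<close>

text \<open>Adding \<open>\<beta> / 2 * (norm x)\<^sup>2\<close> makes \<open>h\<close> convex on \<open>\<Omega>\<close>. A hyperplane
  separating the strict epigraph of this sum from its graph point over \<open>x0\<close> is not vertical,
  because \<open>x0\<close> is interior to \<open>\<Omega>\<close>; its slope is a subgradient of the sum, and subtracting the
  square again leaves the stated quadratic.\<close>

lemma weakly_convex_supporting_quadratic:
  fixes h :: "'a::euclidean_space \<Rightarrow> real"
  assumes wc: "weakly_convex_on \<beta> \<Omega> (\<lambda>x. ereal (h x))" and \<Omega>: "open \<Omega>" "x0 \<in> \<Omega>"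
  obtains w where "\<And>x. x \<in> \<Omega> \<Longrightarrow> h x0 + inner w (x - x0) - \<beta> / 2 * (norm (x - x0))\<^sup>2 \<le> h x"
proof -
  define H where "H x = h x + \<beta> / 2 * (norm x)\<^sup>2" for x
  have "epi (\<lambda>x. ereal (h x) + (if x \<in> \<Omega> then 0 else \<infinity>) + ereal (\<beta> / 2 * (norm x)\<^sup>2))
      = {(x, \<alpha>). x \<in> \<Omega> \<and> H x \<le> \<alpha>}"
    by (auto simp: epi_def H_def split: if_splits)
  then have cE: "convex {(x, \<alpha>). x \<in> \<Omega> \<and> H x \<le> \<alpha>}"
    using wc by (simp add: weakly_convex_on_def)
  define E where "E = {(x, \<alpha>). x \<in> \<Omega> \<and> H x < \<alpha>}"
  have "convex E"
    unfolding convex_def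
  proof (intro ballI allI impI)
    fix p q and u v :: real
    assume p: "p \<in> E" and q: "q \<in> E" and uv: "0 \<le> u" "0 \<le> v" "u + v = 1"
    obtain x \<alpha> y \<gamma> where pq: "p = (x, \<alpha>)" "q = (y, \<gamma>)" by force
    have "u *\<^sub>R (x, H x) + v *\<^sub>R (y, H y) \<in> {(x, \<alpha>). x \<in> \<Omega> \<and> H x \<le> \<alpha>}"
      using p q by (intro convexD[OF cE] uv) (auto simp: pq E_def)
    moreover have "u * H x + v * H y < u * \<alpha> + v * \<gamma>"
    proof (cases "u = 0")
      case True
      then show ?thesis using uv p q by (simp add: pq E_def)
    next
      case False
      then have "u * H x < u * \<alpha>" using uv p by (simp add: pq E_def)
      moreover have "v * H y \<le> v * \<gamma>" using uv q by (simp add: pq E_def mult_left_mono)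
      ultimately show ?thesis by linarith
    qed
    ultimately show "u *\<^sub>R p + v *\<^sub>R q \<in> E" by (auto simp: pq E_def)
  qed
  moreover have "(x0, H x0 + 1) \<in> E" "(x0, H x0) \<notin> E" using \<Omega> by (auto simp: E_def)
  ultimately have "\<exists>a b. a \<noteq> 0 \<and> (\<forall>p\<in>{(x0, H x0)}. inner a p \<le> b) \<and> (\<forall>p\<in>E. b \<le> inner a p)"
    by (intro separating_hyperplane_sets) auto
  then obtain a b where a: "a \<noteq> 0" "inner a (x0, H x0) \<le> b" "\<And>p. p \<in> E \<Longrightarrow> b \<le> inner a p"
    by blast
  obtain c r where ar: "a = (c, r)" by force
  have ineq: "inner c x0 + r * H x0 \<le> inner c x + r * \<alpha>" if "x \<in> \<Omega>" "H x < \<alpha>" for x \<alpha>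
    using a(2) a(3)[of "(x, \<alpha>)"] that by (simp add: ar E_def)
  have "0 \<le> r" using ineq[of x0 "H x0 + 1"] \<Omega> by (simp add: algebra_simps)
  moreover have "r \<noteq> 0"
  proof
    assume "r = 0"
    then have ge: "inner c x0 \<le> inner c x" if "x \<in> \<Omega>" for x
      using ineq[of x "H x + 1"] that by simp
    have "((\<lambda>t. x0 - t *\<^sub>R c) \<longlongrightarrow> x0 - 0 *\<^sub>R c) (at_right 0)" by (intro tendsto_intros)
    then have "\<forall>\<^sub>F t in at_right 0. x0 - t *\<^sub>R c \<in> \<Omega>"
      using \<Omega> by (auto dest: topological_tendstoD)
    moreover have "\<forall>\<^sub>F t in at_right (0::real). t > 0" by (simp add: eventually_at_right_less)
    ultimately have "\<forall>\<^sub>F t in at_right (0::real). inner c c \<le> 0"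
    proof eventually_elim
      case (elim t)
      then have "t * inner c c \<le> 0" using ge[of "x0 - t *\<^sub>R c"] by (simp add: inner_diff_right)
      with elim show ?case by (simp add: mult_le_0_iff)
    qed
    then have "inner c c \<le> 0" by (simp add: eventually_const)
    then have "c = 0" using inner_ge_zero[of c] by (metis antisym inner_eq_zero_iff)
    with \<open>r = 0\<close> a(1) show False by (simp add: ar zero_prod_def)
  qed
  ultimately have "0 < r" by simp
  have sub: "H x0 - inner c (x - x0) / r \<le> H x" if "x \<in> \<Omega>" for x
  proof (rule field_le_epsilon)
    fix \<epsilon> :: real assume "\<epsilon> > 0"
    then have "inner c x0 + r * H x0 \<le> inner c x + r * (H x + \<epsilon>)" using ineq that by simp
    then show "H x0 - inner c (x - x0) / r \<le> H x + \<epsilon>"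
      using \<open>0 < r\<close> by (simp add: field_simps inner_diff_right)
  qed
  have "h x0 + inner (- (1 / r) *\<^sub>R c - \<beta> *\<^sub>R x0) (x - x0) - \<beta> / 2 * (norm (x - x0))\<^sup>2 \<le> h x"
    if "x \<in> \<Omega>" for x
  proof -
    have "(norm (x - x0))\<^sup>2 = (norm x)\<^sup>2 - (norm x0)\<^sup>2 - 2 * inner x0 (x - x0)"
      by (simp add: power2_norm_eq_inner inner_diff_left inner_diff_right inner_commute)
    then have "\<beta> / 2 * (norm (x - x0))\<^sup>2
        = \<beta> / 2 * (norm x)\<^sup>2 - \<beta> / 2 * (norm x0)\<^sup>2 - \<beta> * inner x0 (x - x0)"
      by (simp add: right_diff_distrib)
    then show ?thesis
      using sub[OF that] by (simp add: H_def inner_diff_left add_divide_distrib diff_divide_distrib)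
  qed
  then show ?thesis by (rule that)
qed

text \<open>The supporting quadratic is a smooth minorant of \<open>h\<close> with gradient \<open>w\<close> at \<open>x0\<close>.\<close>

lemma weakly_convex_support_mem_limiting_subdifferential:
  assumes "open \<Omega>" "x0 \<in> \<Omega>"
    and "\<And>x. x \<in> \<Omega> \<Longrightarrow> h x0 + inner w (x - x0) - \<beta> / 2 * (norm (x - x0))\<^sup>2 \<le> h x"
  shows "w \<in> limiting_subdifferential (\<lambda>x. ereal (h x)) x0"
proof -
  have "GDERIV (\<lambda>x. h x0 + inner w (x - x0) - \<beta> / 2 * (norm (x - x0))\<^sup>2) x0
      :> 0 + w - (\<beta> / 2) *\<^sub>R (2 *\<^sub>R (x0 - x0))"
    by (intro GDERIV_diff GDERIV_add GDERIV_const GDERIV_cmult GDERIV_norm_diff_power2)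
      (auto simp: gderiv_def inner_commute intro!: derivative_eq_intros)
  then have "GDERIV (\<lambda>x. h x0 + inner w (x - x0) - \<beta> / 2 * (norm (x - x0))\<^sup>2) x0 :> w"
    by simp
  moreover have "\<forall>\<^sub>F x in nhds x0. h x0 + inner w (x - x0) - \<beta> / 2 * (norm (x - x0))\<^sup>2 \<le> h x"
    using eventually_nhds_in_open[OF assms(1,2)] by eventually_elim (rule assms(3))
  ultimately have "regular_subgradient h x0 w"
    by (intro regular_subgradient_of_smooth_minorant) auto
  then show ?thesis
    by (intro limiting_subdifferentialI[of "\<lambda>_. x0" _ h "\<lambda>_. w" _ UNIV]) auto
qed

section \<open>Multipliers from a decoupled penalization\<close>

text \<open>Solving the minimality inequality for \<open>f z\<close> with the logarithm exhibits a smooth function of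
  \<open>z\<close> that lies below \<open>f\<close> and touches it at \<open>y\<close>.\<close>

lemma regular_subgradient_of_penalized_exp_min:
  assumes k: "k > 0"
    and min: "\<forall>\<^sub>F z in nhds y.
      exp (k * (f y + b)) + k\<^sup>2 * (norm (y - s))\<^sup>2 \<le> exp (k * (f z + b)) + k\<^sup>2 * (norm (z - s))\<^sup>2"
  shows "regular_subgradient f y ((2 * k / exp (k * (f y + b))) *\<^sub>R (s - y))"
proof -
  define e where "e = exp (k * (f y + b))"
  define A where "A = e + k\<^sup>2 * (norm (y - s))\<^sup>2"
  \<comment> \<open>The smooth minorant, as a function of \<open>t = (norm (z - s))\<^sup>2\<close>.\<close>
  define \<theta> where "\<theta> t = ln (A - k\<^sup>2 * t) / k - b" for t
  have Ae: "A - k\<^sup>2 * (norm (y - s))\<^sup>2 = e" "e > 0" by (simp_all add: A_def e_def)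
  have "DERIV \<theta> ((norm (y - s))\<^sup>2) :> - (k / e)"
    unfolding \<theta>_def
    by (rule derivative_eq_intros refl | use Ae k in \<open>simp add: power2_eq_square\<close>)+
  then have "GDERIV (\<lambda>z. \<theta> ((norm (z - s))\<^sup>2)) y :> - (k / e) *\<^sub>R (2 *\<^sub>R (y - s))"
    by (rule GDERIV_DERIV_compose[OF GDERIV_norm_diff_power2])
  moreover have "- (k / e) *\<^sub>R (2 *\<^sub>R (y - s)) = (2 * k / e) *\<^sub>R (s - y)"
    by (simp add: scaleR_diff_right mult.commute)
  ultimately have "GDERIV (\<lambda>z. \<theta> ((norm (z - s))\<^sup>2)) y :> (2 * k / e) *\<^sub>R (s - y)"
    by simp
  moreover have "\<theta> ((norm (y - s))\<^sup>2) = f y"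
    using k by (simp add: \<theta>_def Ae(1)) (simp add: e_def)
  moreover have "\<forall>\<^sub>F z in nhds y. \<theta> ((norm (z - s))\<^sup>2) \<le> f z"
  proof -
    have "((\<lambda>z. A - k\<^sup>2 * (norm (z - s))\<^sup>2) \<longlongrightarrow> A - k\<^sup>2 * (norm (y - s))\<^sup>2) (nhds y)"
      by (intro tendsto_intros) (simp_all add: filterlim_ident)
    then have "\<forall>\<^sub>F z in nhds y. 0 < A - k\<^sup>2 * (norm (z - s))\<^sup>2"
      using Ae by (intro order_tendstoD(1)) auto
    with min show ?thesis
    proof eventually_elim
      case (elim z)
      have "ln (A - k\<^sup>2 * (norm (z - s))\<^sup>2) \<le> ln (exp (k * (f z + b)))"
        using elim by (intro ln_mono) (auto simp: A_def e_def)
      then show ?case using k by (simp add: \<theta>_def field_simps)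
    qed
  qed
  ultimately show ?thesis
    unfolding e_def[symmetric] by (rule regular_subgradient_of_smooth_minorant)
qed

text \<open>An approximate multiplier rule with every subgradient taken at a point of its own. It comes from
  the penalized problem described at the beginning. The weights \<open>k\<^sup>2\<close> and \<open>k\<close> are balanced:
  the distances \<open>norm (y i - s)\<close> must be of order \<open>1 / k\<close> to keep the sum of the exponentials away from
  \<open>0\<close>, while the weight on \<open>norm (s - xbar)\<close> has to tend to infinity and yet leave a vanishing
  gradient after division by \<open>k\<close>.\<close>

lemma fuzzy_multiplier_rule:
  fixes S :: "'a::euclidean_space set" and f q :: "'i \<Rightarrow> 'a \<Rightarrow> real" and G :: "'i \<Rightarrow> 'a \<Rightarrow> 'a"
  assumes I: "finite I" "I \<noteq> {}" and S: "closed S" "xbar \<in> S" and \<epsilon>: "0 < \<epsilon>" "\<epsilon> \<le> r"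
    and lip: "\<And>i. i \<in> I \<Longrightarrow> L-lipschitz_on (cball xbar r) (f i)"
    and q: "\<And>i x. i \<in> I \<Longrightarrow> x \<in> cball xbar r \<Longrightarrow> GDERIV (q i) x :> G i x"
    and weak: "\<And>x. x \<in> S \<inter> cball xbar r \<Longrightarrow> \<exists>i\<in>I. f i xbar + q i xbar \<le> f i x + q i x"
  shows "\<exists>s y v l w. s \<in> S \<and> dist s xbar < \<epsilon> \<and>
    (\<forall>i\<in>I. dist (y i) xbar < \<epsilon> \<and> regular_subgradient (f i) (y i) (v i) \<and> 0 < l i) \<and>
    sum l I = 1 \<and> w \<in> regular_normal_cone S s \<and>
    norm (w + (\<Sum>i\<in>I. l i *\<^sub>R (v i + G i s))) < \<epsilon>"
proof -
  have "0 < r" using \<epsilon> by simp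
  have "0 \<le> L" using lip I lipschitz_on_nonneg by blast
  define M where "M = real (card I)"
  have "0 < M" using I by (simp add: M_def card_gt_0_iff)
  \<comment> \<open>The lower bound, independent of \<open>k\<close>, for the sum of the exponentials at the minimizer.\<close>
  define B where "B = exp (- (L * sqrt M))"
  have "0 < B" by (simp add: B_def)
  have "((\<lambda>k. sqrt (M / k)) \<longlongrightarrow> sqrt 0) at_top"
    by (intro tendsto_real_sqrt tendsto_divide_0[OF tendsto_const] filterlim_at_top_imp_at_infinity
        filterlim_ident)
  then have "\<forall>\<^sub>F k in at_top. sqrt (M / k) < min (\<epsilon> / 2) (\<epsilon> * B / 2)"
    using \<epsilon> \<open>0 < B\<close> by (intro order_tendstoD(2)) auto
  then have "\<exists>k\<ge>1. sqrt (M / k) < min (\<epsilon> / 2) (\<epsilon> * B / 2)"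
    by (auto simp: eventually_at_top_linorder) (metis max.cobounded1 max.cobounded2)
  then obtain k where "1 \<le> k" and "sqrt (M / k) < min (\<epsilon> / 2) (\<epsilon> * B / 2)" by blast
  moreover define \<eta> where "\<eta> = sqrt (M / k)"
  ultimately have k: "0 < k" "1 \<le> k" and \<eta>: "2 * \<eta> < \<epsilon>" "2 * \<eta> < \<epsilon> * B" by auto
  define e where "e i y s = exp (k * (f i y + (q i s - (f i xbar + q i xbar))))" for i y s
  have e_pos: "0 < e i y s" for i y s by (simp add: e_def)
  define \<Psi> where "\<Psi> y s =
    (\<Sum>i\<in>I. e i (y i) s + k\<^sup>2 * (norm (y i - s))\<^sup>2) + k * (norm (s - xbar))\<^sup>2" for y s
  define K where "K = PiE UNIV (\<lambda>_::'i. cball xbar r) \<times> (S \<inter> cball xbar r)"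
  have "compact K"
    unfolding K_def by (intro compact_Times compact_PiE_UNIV) (simp_all add: S closed_Int_compact)
  moreover have "((\<lambda>_. xbar), xbar) \<in> K"
    using S \<open>0 < r\<close> by (simp add: K_def PiE_iff)
  moreover have "continuous_on K (\<lambda>p. \<Psi> (fst p) (snd p))"
  proof -
    have y: "continuous_on K (\<lambda>p. fst p i)" for i
      by (rule continuous_on_compose2[OF continuous_on_product_coordinates
            continuous_on_fst[OF continuous_on_id]]) simp
    have fy: "continuous_on K (\<lambda>p. f i (fst p i))" if "i \<in> I" for i
      by (rule continuous_on_compose2[OF lipschitz_on_continuous_on[OF lip[OF that]] y])
        (auto simp: K_def PiE_iff)
    have "continuous_on (cball xbar r) (q i)" if "i \<in> I" for i
      using q[OF that] by (auto simp: gderiv_def intro!: continuous_at_imp_continuous_on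
          has_derivative_continuous)
    then have qs: "continuous_on K (\<lambda>p. q i (snd p))" if "i \<in> I" for i
      by (rule continuous_on_compose2[OF _ continuous_on_snd[OF continuous_on_id]])
        (use that in \<open>auto simp: K_def\<close>)
    show ?thesis
      unfolding \<Psi>_def e_def by (intro y fy qs continuous_intros)
  qed
  ultimately obtain p where p: "p \<in> K" "\<And>p'. p' \<in> K \<Longrightarrow> \<Psi> (fst p) (snd p) \<le> \<Psi> (fst p') (snd p')"
    using continuous_attains_inf[of K "\<lambda>p. \<Psi> (fst p) (snd p)"] by blast
  obtain y s where "p = (y, s)" by force
  then have yK: "\<And>i. y i \<in> cball xbar r" and sK: "s \<in> S" "s \<in> cball xbar r"
    and opt: "\<And>y' s'. (y', s') \<in> K \<Longrightarrow> \<Psi> y s \<le> \<Psi> y' s'"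
    using p by (auto simp: K_def PiE_iff)
  have "\<Psi> y s \<le> \<Psi> (\<lambda>_. xbar) xbar" using opt \<open>((\<lambda>_. xbar), xbar) \<in> K\<close> .
  also have "\<dots> = M" by (simp add: \<Psi>_def e_def M_def)
  finally have "\<Psi> y s \<le> M" .
  have nonneg: "0 \<le> e i (y i) s + k\<^sup>2 * (norm (y i - s))\<^sup>2" for i
    using e_pos[of i "y i" s] by simp
  have "0 \<le> (\<Sum>i\<in>I. e i (y i) s + k\<^sup>2 * (norm (y i - s))\<^sup>2)"
    by (rule sum_nonneg) (rule nonneg)
  then have "k * (norm (s - xbar))\<^sup>2 \<le> M"
    using \<open>\<Psi> y s \<le> M\<close> unfolding \<Psi>_def by linarith
  then have s_close: "norm (s - xbar) \<le> \<eta>"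
    unfolding \<eta>_def using k by (intro real_le_rsqrt) (simp add: field_simps)
  have y_bound: "k\<^sup>2 * (norm (y i - s))\<^sup>2 \<le> M" if "i \<in> I" for i
  proof -
    have "e i (y i) s + k\<^sup>2 * (norm (y i - s))\<^sup>2 \<le> (\<Sum>i\<in>I. e i (y i) s + k\<^sup>2 * (norm (y i - s))\<^sup>2)"
      using I that nonneg by (intro member_le_sum) auto
    moreover have "0 \<le> k * (norm (s - xbar))\<^sup>2" using k by simp
    ultimately show ?thesis
      using \<open>\<Psi> y s \<le> M\<close> e_pos[of i "y i" s] unfolding \<Psi>_def by linarith
  qed
  have y_close: "k * norm (y i - s) \<le> sqrt M" "norm (y i - s) \<le> \<eta>" if "i \<in> I" for i
  proof -
    show *: "k * norm (y i - s) \<le> sqrt M"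
      using y_bound[OF that] by (intro real_le_rsqrt) (simp add: power_mult_distrib)
    have "k * (norm (y i - s))\<^sup>2 \<le> k\<^sup>2 * (norm (y i - s))\<^sup>2"
      using k by (intro mult_right_mono) (auto simp: power2_eq_square)
    with y_bound[OF that] have "(norm (y i - s))\<^sup>2 \<le> M / k"
      using k by (simp add: field_simps)
    then show "norm (y i - s) \<le> \<eta>" unfolding \<eta>_def by (rule real_le_rsqrt)
  qed
  have "0 \<le> \<eta>" using s_close norm_ge_zero order_trans by blast
  then have s_near: "dist s xbar < \<epsilon>" using s_close \<eta> by (simp add: dist_norm)
  have y_near: "dist (y i) xbar < \<epsilon>" if "i \<in> I" for i
    using y_close(2)[OF that] s_close \<eta> norm_triangle_ineq[of "y i - s" "s - xbar"]
    by (simp add: dist_norm)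
  \<comment> \<open>Varying \<open>y j\<close> alone affects only the terms of index \<open>j\<close>.\<close>
  have y_sub: "regular_subgradient (f j) (y j) ((2 * k / e j (y j) s) *\<^sub>R (s - y j))"
    if j: "j \<in> I" for j
  proof -
    have "\<forall>\<^sub>F z in nhds (y j). z \<in> ball xbar r"
      using y_near[OF j] \<epsilon> by (intro eventually_nhds_in_open) (auto simp: dist_commute)
    then have "\<forall>\<^sub>F z in nhds (y j). e j (y j) s + k\<^sup>2 * (norm (y j - s))\<^sup>2
        \<le> e j z s + k\<^sup>2 * (norm (z - s))\<^sup>2"
    proof eventually_elim
      case (elim z)
      have "(y(j := z), s) \<in> K" using elim yK sK by (auto simp: K_def)
      then have "\<Psi> y s \<le> \<Psi> (y(j := z)) s" by (rule opt)
      then show ?case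
        by (simp add: \<Psi>_def sum.remove[OF I(1) j])
    qed
    then show ?thesis unfolding e_def using k by (intro regular_subgradient_of_penalized_exp_min)
  qed
  \<comment> \<open>\<open>f\<close> is only evaluated at the \<open>y i\<close>, so \<open>\<Psi> y\<close> is differentiable; \<open>D\<close> is its gradient at \<open>s\<close>.\<close>
  define D where "D = (\<Sum>i\<in>I. (k * e i (y i) s) *\<^sub>R G i s + k\<^sup>2 *\<^sub>R (2 *\<^sub>R (s - y i)))
    + k *\<^sub>R (2 *\<^sub>R (s - xbar))"
  have "GDERIV (\<Psi> y) s :> D"
  proof -
    have "GDERIV (e i (y i)) s :> (k * e i (y i) s) *\<^sub>R G i s" if "i \<in> I" for i
    proof -
      have "DERIV (\<lambda>t. exp (k * (f i (y i) + (t - (f i xbar + q i xbar))))) (q i s) :> k * e i (y i) s"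
        unfolding e_def by (auto intro!: derivative_eq_intros)
      then show ?thesis
        using GDERIV_DERIV_compose[OF q[OF that sK(2)]] unfolding e_def by fastforce
    qed
    moreover have "GDERIV (\<lambda>s. (norm (y i - s))\<^sup>2) s :> 2 *\<^sub>R (s - y i)" for i
      using GDERIV_norm_diff_power2[of "y i" s] by (simp add: norm_minus_commute)
    ultimately show ?thesis
      unfolding \<Psi>_def D_def
      by (intro GDERIV_add GDERIV_sum GDERIV_cmult GDERIV_norm_diff_power2)
  qed
  moreover have "\<forall>\<^sub>F s' in at s within S. \<Psi> y s \<le> \<Psi> y s'"
  proof -
    have "\<forall>\<^sub>F s' in nhds s. s' \<in> ball xbar r"
      using s_near \<epsilon> by (intro eventually_nhds_in_open) (auto simp: dist_commute)
    then have "\<forall>\<^sub>F s' in at s within S. s' \<in> ball xbar r \<and> s' \<in> S"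
      by (auto simp: eventually_at_filter elim: eventually_mono)
    then show ?thesis
      by eventually_elim (rule opt, use yK in \<open>auto simp: K_def PiE_iff\<close>)
  qed
  ultimately have "- D \<in> regular_normal_cone S s"
    by (rule neg_gradient_mem_regular_normal_cone)
  define E where "E = (\<Sum>i\<in>I. e i (y i) s)"
  obtain j where j: "j \<in> I" "f j xbar + q j xbar \<le> f j s + q j s"
    using weak sK by blast
  have "B \<le> e j (y j) s"
  proof -
    have "f j s - f j (y j) \<le> L * norm (y j - s)"
      using lipschitz_onD[OF lip[OF j(1)] yK[of j] sK(2)] by (simp add: dist_norm)
    then have "- (L * norm (y j - s)) \<le> f j (y j) + (q j s - (f j xbar + q j xbar))"
      using j(2) by linarith
    then have "k * - (L * norm (y j - s)) \<le> k * (f j (y j) + (q j s - (f j xbar + q j xbar)))"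
      using k by (intro mult_left_mono) auto
    moreover have "L * (k * norm (y j - s)) \<le> L * sqrt M"
      using \<open>0 \<le> L\<close> y_close(1)[OF j(1)] by (rule mult_left_mono[rotated])
    ultimately show ?thesis by (simp add: B_def e_def algebra_simps)
  qed
  also have "\<dots> \<le> E"
    unfolding E_def using I j(1) by (intro member_le_sum) (auto simp: less_imp_le[OF e_pos])
  finally have "B \<le> E" .
  then have "0 < E" using \<open>0 < B\<close> by simp
  \<comment> \<open>Dividing by \<open>k * E\<close> normalizes the multipliers.\<close>
  define w where "w = (1 / (k * E)) *\<^sub>R (- D)"
  define v where "v i = (2 * k / e i (y i) s) *\<^sub>R (s - y i)" for i
  define l where "l i = e i (y i) s / E" for i
  have "w \<in> regular_normal_cone S s"
    unfolding w_def using \<open>- D \<in> _\<close> k \<open>0 < E\<close> by (intro regular_normal_cone_scaleR) auto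
  moreover have "sum l I = 1"
    using \<open>0 < E\<close> by (simp add: l_def E_def flip: sum_divide_distrib)
  moreover have "norm (w + (\<Sum>i\<in>I. l i *\<^sub>R (v i + G i s))) < \<epsilon>"
  proof -
    have "(1 / (k * E)) *\<^sub>R ((k * e i (y i) s) *\<^sub>R G i s + k\<^sup>2 *\<^sub>R (2 *\<^sub>R (s - y i)))
        = l i *\<^sub>R (v i + G i s)" for i
      using k \<open>0 < E\<close> e_pos[of i "y i" s]
      by (simp add: l_def v_def scaleR_add_right power2_eq_square)
    then have "(1 / (k * E)) *\<^sub>R D = (\<Sum>i\<in>I. l i *\<^sub>R (v i + G i s)) + (2 / E) *\<^sub>R (s - xbar)"
      using k by (simp add: D_def scaleR_add_right scaleR_sum_right)
    then have "norm (w + (\<Sum>i\<in>I. l i *\<^sub>R (v i + G i s))) = 2 / E * norm (s - xbar)"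
      using \<open>0 < E\<close> by (simp add: w_def)
    also have "\<dots> \<le> 2 / B * \<eta>"
      using \<open>B \<le> E\<close> \<open>0 < B\<close> s_close by (intro mult_mono divide_left_mono) auto
    also have "\<dots> < \<epsilon>" using \<eta> \<open>0 < B\<close> by (simp add: field_simps)
    finally show ?thesis .
  qed
  ultimately show ?thesis
    using sK(1) s_near y_near y_sub e_pos \<open>0 < E\<close>
    by (intro exI[of _ s] exI[of _ y] exI[of _ v] exI[of _ l] exI[of _ w])
      (auto simp: v_def l_def)
qed

text \<open>The multipliers sum to \<open>1\<close>, so some multiplier survives in the limit. A multiplier may vanish
  there; its subgradient still converges, since the bound on the subgradients does not depend on the
  multipliers.\<close>

lemma limiting_multiplier_rule:
  fixes S :: "'a::euclidean_space set" and f q :: "'i::countable \<Rightarrow> 'a \<Rightarrow> real"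
    and G :: "'i \<Rightarrow> 'a \<Rightarrow> 'a" and \<phi> :: "'i \<Rightarrow> 'a \<Rightarrow> ereal"
  assumes I: "finite I" "I \<noteq> {}" and S: "closed S" "xbar \<in> S" and r: "0 < r"
    and \<phi>: "\<And>i x. i \<in> I \<Longrightarrow> x \<in> ball xbar r \<Longrightarrow> \<phi> i x = ereal (f i x)"
    and lip: "\<And>i. i \<in> I \<Longrightarrow> L-lipschitz_on (cball xbar r) (f i)"
    and q: "\<And>i x. i \<in> I \<Longrightarrow> x \<in> cball xbar r \<Longrightarrow> GDERIV (q i) x :> G i x"
    and G: "\<And>i. i \<in> I \<Longrightarrow> isCont (G i) xbar"
    and weak: "\<And>x. x \<in> S \<inter> cball xbar r \<Longrightarrow> \<exists>i\<in>I. f i xbar + q i xbar \<le> f i x + q i x"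
  obtains l v where "\<And>i. i \<in> I \<Longrightarrow> 0 \<le> l i" "sum l I = 1"
    "\<And>i. i \<in> I \<Longrightarrow> v i \<in> limiting_subdifferential (\<phi> i) xbar"
    "- (\<Sum>i\<in>I. l i *\<^sub>R (v i + G i xbar)) \<in> limiting_normal_cone S xbar"
proof -
  define \<epsilon> where "\<epsilon> n = r * inverse (real (Suc n))" for n
  have \<epsilon>: "0 < \<epsilon> n" "\<epsilon> n \<le> r" for n
    using r by (simp_all add: \<epsilon>_def divide_le_eq flip: divide_inverse)
  have "\<epsilon> \<longlonglongrightarrow> r * 0"
    unfolding \<epsilon>_def by (intro tendsto_intros LIMSEQ_inverse_real_of_nat)
  then have \<epsilon>0: "\<epsilon> \<longlonglongrightarrow> 0" by simp
  have "\<forall>n. \<exists>s y v l w. s \<in> S \<and> dist s xbar < \<epsilon> n \<and>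
    (\<forall>i\<in>I. dist (y i) xbar < \<epsilon> n \<and> regular_subgradient (f i) (y i) (v i) \<and> 0 < l i) \<and>
    sum l I = 1 \<and> w \<in> regular_normal_cone S s \<and>
    norm (w + (\<Sum>i\<in>I. l i *\<^sub>R (v i + G i s))) < \<epsilon> n"
    using \<epsilon> by (intro allI fuzzy_multiplier_rule[OF I S _ _ lip q weak])
  then obtain s y v l w where s: "\<And>n. s n \<in> S" "\<And>n. dist (s n) xbar < \<epsilon> n"
    and y: "\<And>n i. i \<in> I \<Longrightarrow> dist (y n i) xbar < \<epsilon> n"
    and v: "\<And>n i. i \<in> I \<Longrightarrow> regular_subgradient (f i) (y n i) (v n i)"
    and l: "\<And>n i. i \<in> I \<Longrightarrow> 0 < l n i" "\<And>n. sum (l n) I = 1"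
    and w: "\<And>n. w n \<in> regular_normal_cone S (s n)"
      "\<And>n. norm (w n + (\<Sum>i\<in>I. l n i *\<^sub>R (v n i + G i (s n)))) < \<epsilon> n"
    unfolding choice_iff by blast
  have y_ball: "y n i \<in> ball xbar r" if "i \<in> I" for n i
    using y[OF that, of n] \<epsilon>(2)[of n] by (simp add: dist_commute)
  have "0 \<le> L" using lip I lipschitz_on_nonneg by blast
  have v_le: "norm (v n i) \<le> L" if "i \<in> I" for n i
    using regular_subgradient_norm_le[OF v[OF that] open_ball y_ball[OF that]]
      lipschitz_on_subset[OF lip[OF that] ball_subset_cball] by blast
  have l_le: "l n i \<le> 1" if "i \<in> I" for n i
    using member_le_sum[OF that, of "l n"] l I by (metis DiffE less_imp_le)
  \<comment> \<open>All multipliers and subgradients form one sequence in a compact product, so that a single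
    subsequence serves every index; the entries outside \<open>I\<close> are dummies.\<close>
  define Z where "Z n i = (if i \<in> I then (l n i, v n i) else (0, 0))" for n i
  have "seq_compact (PiE UNIV (\<lambda>_::'i. cball (0::real) 1 \<times> cball (0::'a) L))"
    by (intro compact_imp_seq_compact compact_PiE_UNIV compact_Times compact_cball)
  moreover have "Z n i \<in> cball 0 1 \<times> cball 0 L" for n i
    using l_le[of i n] v_le[of i n] l(1)[of i n] \<open>0 \<le> L\<close> by (cases "i \<in> I") (simp_all add: Z_def)
  then have "\<forall>n. Z n \<in> PiE UNIV (\<lambda>_. cball 0 1 \<times> cball 0 L)" by (simp add: PiE_iff)
  ultimately obtain z \<rho> where \<rho>: "strict_mono (\<rho> :: nat \<Rightarrow> nat)" "(Z \<circ> \<rho>) \<longlonglongrightarrow> z"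
    by (rule seq_compactE)
  have Z_lim: "(\<lambda>n. Z (\<rho> n) i) \<longlonglongrightarrow> z i" for i
    using continuous_on_tendsto_compose[OF continuous_on_product_coordinates \<rho>(2), of i]
    by (simp add: o_def)
  have l_lim: "(\<lambda>n. l (\<rho> n) i) \<longlonglongrightarrow> fst (z i)"
    and v_lim: "(\<lambda>n. v (\<rho> n) i) \<longlonglongrightarrow> snd (z i)" if "i \<in> I" for i
    using tendsto_fst[OF Z_lim[of i]] tendsto_snd[OF Z_lim[of i]] that by (simp_all add: Z_def)
  have \<epsilon>\<rho>: "(\<lambda>n. \<epsilon> (\<rho> n)) \<longlonglongrightarrow> 0"
    using LIMSEQ_subseq_LIMSEQ[OF \<epsilon>0 \<rho>(1)] by (simp add: o_def)
  have s_lim: "(\<lambda>n. s (\<rho> n)) \<longlonglongrightarrow> xbar"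
    by (rule iffD2[OF tendsto_dist_iff], rule tendsto_sandwich[OF _ _ tendsto_const \<epsilon>\<rho>]) (auto intro!: always_eventually less_imp_le s)
  have y_lim: "(\<lambda>n. y (\<rho> n) i) \<longlonglongrightarrow> xbar" if "i \<in> I" for i
    by (rule iffD2[OF tendsto_dist_iff], rule tendsto_sandwich[OF _ _ tendsto_const \<epsilon>\<rho>])
      (auto intro!: always_eventually less_imp_le y that)
  have "(\<lambda>n. \<Sum>i\<in>I. l (\<rho> n) i *\<^sub>R (v (\<rho> n) i + G i (s (\<rho> n))))
      \<longlonglongrightarrow> (\<Sum>i\<in>I. fst (z i) *\<^sub>R (snd (z i) + G i xbar))"
    by (intro tendsto_intros l_lim v_lim isCont_tendsto_compose[OF G s_lim])
  moreover have "(\<lambda>n. w (\<rho> n) + (\<Sum>i\<in>I. l (\<rho> n) i *\<^sub>R (v (\<rho> n) i + G i (s (\<rho> n))))) \<longlonglongrightarrow> 0"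
    by (rule Lim_null_comparison[OF _ \<epsilon>\<rho>]) (auto intro!: always_eventually less_imp_le w)
  ultimately have w_lim: "(\<lambda>n. w (\<rho> n)) \<longlonglongrightarrow> - (\<Sum>i\<in>I. fst (z i) *\<^sub>R (snd (z i) + G i xbar))"
    using tendsto_diff by fastforce
  show ?thesis
  proof (rule that)
    show "0 \<le> fst (z i)" if "i \<in> I" for i
      by (rule tendsto_lowerbound[OF l_lim[OF that]])
        (auto intro!: always_eventually less_imp_le l that)
    have "(\<lambda>n. sum (l (\<rho> n)) I) \<longlonglongrightarrow> (\<Sum>i\<in>I. fst (z i))"
      by (intro tendsto_intros l_lim)
    then show "(\<Sum>i\<in>I. fst (z i)) = 1"
      by (simp add: l LIMSEQ_const_iff)
    show "snd (z i) \<in> limiting_subdifferential (\<phi> i) xbar" if i: "i \<in> I" for i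
    proof (rule limiting_subdifferentialI[OF y_lim[OF i] _ v_lim[OF i] v[OF i]
          open_ball y_ball[OF i] _ \<phi>[OF i]])
      have "continuous_on (cball xbar r) (f i)"
        using lip[OF i] by (rule lipschitz_on_continuous_on)
      then show "(\<lambda>n. f i (y (\<rho> n) i)) \<longlonglongrightarrow> f i xbar"
        using y_lim[OF i] y_ball[OF i] r
        by (elim continuous_on_tendsto_compose) (auto intro!: always_eventually less_imp_le)
    qed (use r in auto)
    show "- (\<Sum>i\<in>I. fst (z i) *\<^sub>R (snd (z i) + G i xbar)) \<in> limiting_normal_cone S xbar"
      by (rule limiting_normal_coneI[OF s(1) w(1) s_lim w_lim])
  qed
qed

section \<open>Stationarity of local weak Pareto solutions\<close>

theorem theorem3p5:
  fixes S \<Omega> :: "(real ^ 'n) set"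
    and m :: nat
    and \<beta> :: real
    and f g :: "nat \<Rightarrow> real ^ 'n \<Rightarrow> ereal"
    and h :: "nat \<Rightarrow> real ^ 'n \<Rightarrow> real"
    and xbar :: "real ^ 'n"
  assumes "S \<noteq> {}" and "closed S"
    and "0 \<le> \<beta>"
    and "open \<Omega>" and "S \<subseteq> \<Omega>"
    and "\<And>i x. i \<in> {1..m} \<Longrightarrow> f i x \<noteq> -\<infinity>"
    and "\<And>i x. i \<in> {1..m} \<Longrightarrow> g i x \<noteq> -\<infinity>"
    and "\<And>i. i \<in> {1..m} \<Longrightarrow> locally_Lipschitz_on \<Omega> (f i)"
    and "\<And>i. i \<in> {1..m} \<Longrightarrow> continuously_differentiable_on \<Omega> (g i)"
    and "\<And>i. i \<in> {1..m} \<Longrightarrow> weakly_convex_on \<beta> \<Omega> (\<lambda>x. ereal (h i x))"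
    and "xbar \<in> S"
    and "local_weak_Pareto {1..m} S (\<lambda>i x. f i x + g i x - ereal (h i x)) xbar"
  shows "stationary_point m S f g h xbar"
proof -
  let ?I = "{1..m}"
  let ?F = "\<lambda>i x. f i x + g i x - ereal (h i x)"
  have "xbar \<in> \<Omega>" using assms by blast
  obtain V where V: "open V" "xbar \<in> V" "\<And>x. x \<in> S \<inter> V \<Longrightarrow> \<exists>i\<in>?I. \<not> ?F i x < ?F i xbar"
    using assms(12) unfolding local_weak_Pareto_def by blast
  \<comment> \<open>For \<open>m = 0\<close> the point \<open>xbar\<close> would vacuously dominate itself.\<close>
  have "?I \<noteq> {}" using V(3)[of xbar] V(2) assms(11) by blast
  have "\<forall>i\<in>?I. \<exists>w. \<forall>x\<in>\<Omega>. h i xbar + inner w (x - xbar) - \<beta> / 2 * (norm (x - xbar))\<^sup>2 \<le> h i x"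
    by (meson weakly_convex_supporting_quadratic[OF assms(10) \<open>open \<Omega>\<close> \<open>xbar \<in> \<Omega>\<close>])
  then obtain w where w: "\<And>i x. i \<in> ?I \<Longrightarrow> x \<in> \<Omega> \<Longrightarrow>
      h i xbar + inner (w i) (x - xbar) - \<beta> / 2 * (norm (x - xbar))\<^sup>2 \<le> h i x"
    by metis
  have "\<forall>i\<in>?I. \<exists>U L. open U \<and> xbar \<in> U \<and> (\<forall>y\<in>U. \<bar>f i y\<bar> \<noteq> \<infinity>) \<and>
      L-lipschitz_on U (\<lambda>y. real_of_ereal (f i y))"
    using assms(8) \<open>xbar \<in> \<Omega>\<close> unfolding locally_Lipschitz_on_def by blast
  then obtain U and L :: "nat \<Rightarrow> real" where
    U: "\<And>i. i \<in> ?I \<Longrightarrow> open (U i)" "\<And>i. i \<in> ?I \<Longrightarrow> xbar \<in> U i"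
    and f_fin: "\<And>i y. i \<in> ?I \<Longrightarrow> y \<in> U i \<Longrightarrow> \<bar>f i y\<bar> \<noteq> \<infinity>"
    and lip: "\<And>i. i \<in> ?I \<Longrightarrow> (L i)-lipschitz_on (U i) (\<lambda>y. real_of_ereal (f i y))"
    by metis
  have "open (\<Omega> \<inter> V \<inter> (\<Inter>i\<in>?I. U i))"
    using assms(4) V(1) U(1) by (intro open_Int open_INT) simp_all
  moreover have "xbar \<in> \<Omega> \<inter> V \<inter> (\<Inter>i\<in>?I. U i)"
    using V(2) U(2) \<open>xbar \<in> \<Omega>\<close> by blast
  ultimately obtain r where "r > 0" and r: "cball xbar r \<subseteq> \<Omega> \<inter> V \<inter> (\<Inter>i\<in>?I. U i)"
    by (meson open_contains_cball)
  have ball: "x \<in> \<Omega>" "x \<in> V" "i \<in> ?I \<Longrightarrow> x \<in> U i" if "x \<in> cball xbar r" for i x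
    using r that by blast+
  have g: "\<bar>g i x\<bar> \<noteq> \<infinity>" "GDERIV (\<lambda>y. real_of_ereal (g i y)) x :> gradient (g i) x"
    if "i \<in> ?I" "x \<in> \<Omega>" for i x
    using assms(9)[OF that(1)] that(2) by (auto simp: continuously_differentiable_on_def)
  \<comment> \<open>The smooth part of the objective after \<open>h i\<close> is replaced by its supporting quadratic; the
    constant \<open>h i xbar\<close> is dropped.\<close>
  define q where "q i x = real_of_ereal (g i x) - inner (w i) (x - xbar) + \<beta> / 2 * (norm (x - xbar))\<^sup>2"
    for i x
  define G where "G i x = gradient (g i) x - w i + (\<beta> / 2) *\<^sub>R (2 *\<^sub>R (x - xbar))" for i x
  obtain l v where l: "\<And>i. i \<in> ?I \<Longrightarrow> 0 \<le> l i" "sum l ?I = 1"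
    and v: "\<And>i. i \<in> ?I \<Longrightarrow> v i \<in> limiting_subdifferential (f i) xbar"
    and normal: "- (\<Sum>i\<in>?I. l i *\<^sub>R (v i + G i xbar)) \<in> limiting_normal_cone S xbar"
  proof (rule limiting_multiplier_rule[of ?I S xbar r f "\<lambda>i x. real_of_ereal (f i x)" "sum (\<lambda>i. \<bar>L i\<bar>) ?I" q G])
    show "f i x = ereal (real_of_ereal (f i x))" if "i \<in> ?I" "x \<in> ball xbar r" for i x
      using f_fin[of i x] that(1) ball(3)[of x i] that(2) by (simp add: ereal_real)
    show "(\<Sum>i\<in>?I. \<bar>L i\<bar>)-lipschitz_on (cball xbar r) (\<lambda>x. real_of_ereal (f i x))" if "i \<in> ?I" for i
    proof (rule lipschitz_on_mono[OF lip[OF that]])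
      have "\<bar>L i\<bar> \<le> (\<Sum>i\<in>?I. \<bar>L i\<bar>)" using that by (intro member_le_sum) auto
      then show "L i \<le> (\<Sum>i\<in>?I. \<bar>L i\<bar>)" by simp
    qed (use ball(3) that in blast)
    show "GDERIV (q i) x :> G i x" if "i \<in> ?I" "x \<in> cball xbar r" for i x
    proof -
      have "GDERIV (\<lambda>x. inner (w i) (x - xbar)) x :> w i"
        by (auto simp: gderiv_def inner_commute intro!: derivative_eq_intros)
      then show ?thesis
        unfolding q_def G_def
        by (intro GDERIV_diff GDERIV_add GDERIV_cmult GDERIV_norm_diff_power2 g(2) that(1) ball(1)[OF that(2)])
    qed
    show "isCont (G i) xbar" if "i \<in> ?I" for i
    proof -
      have "isCont (gradient (g i)) xbar"
        using assms(9)[OF that] assms(4) \<open>xbar \<in> \<Omega>\<close>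
        by (auto simp: continuously_differentiable_on_def continuous_on_eq_continuous_at)
      then show ?thesis unfolding G_def by (intro continuous_intros)
    qed
    show "\<exists>i\<in>?I. real_of_ereal (f i xbar) + q i xbar \<le> real_of_ereal (f i x) + q i x"
      if x: "x \<in> S \<inter> cball xbar r" for x
    proof -
      obtain i where i: "i \<in> ?I" "\<not> ?F i x < ?F i xbar" using V(3)[of x] x ball(2)[of x] by blast
      have "x \<in> \<Omega>" "x \<in> U i" using x ball(1,3)[of x] i by blast+
      then obtain a b a' b' where "f i x = ereal a" "g i x = ereal b"
          "f i xbar = ereal a'" "g i xbar = ereal b'"
        using f_fin[OF i(1) \<open>x \<in> U i\<close>] g(1)[OF i(1) \<open>x \<in> \<Omega>\<close>]
          f_fin[OF i(1) U(2)[OF i(1)]] g(1)[OF i(1) \<open>xbar \<in> \<Omega>\<close>]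
        unfolding not_infty_ereal by blast
      with i(2) have "real_of_ereal (f i xbar) + real_of_ereal (g i xbar) - h i xbar
          \<le> real_of_ereal (f i x) + real_of_ereal (g i x) - h i x"
        by (simp add: not_less)
      then show ?thesis
        using w[OF i(1) \<open>x \<in> \<Omega>\<close>] by (intro bexI[OF _ i(1)]) (simp add: q_def)
    qed
  qed (use assms \<open>?I \<noteq> {}\<close> \<open>r > 0\<close> in auto)
  have w_sub: "w i \<in> limiting_subdifferential (\<lambda>y. ereal (h i y)) xbar" if "i \<in> ?I" for i
    using weakly_convex_support_mem_limiting_subdifferential[OF assms(4) \<open>xbar \<in> \<Omega>\<close> w[OF that]] .
  define A where "A i = (*\<^sub>R) (l i) `
      (minkowski_diff (limiting_subdifferential (f i) xbar + {gradient (g i) xbar})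
        (limiting_subdifferential (\<lambda>y. ereal (h i y)) xbar))" for i
  have "l i *\<^sub>R (v i + G i xbar) \<in> A i" if "i \<in> ?I" for i
  proof -
    have "v i + G i xbar = (v i + gradient (g i) xbar) - w i" by (simp add: G_def)
    moreover have "v i + gradient (g i) xbar \<in> limiting_subdifferential (f i) xbar + {gradient (g i) xbar}"
      using v[OF that] by (rule set_plus_intro) simp
    ultimately show ?thesis
      using w_sub[OF that] unfolding A_def minkowski_diff_def by blast
  qed
  then have "(\<Sum>i\<in>?I. l i *\<^sub>R (v i + G i xbar)) \<in> (\<Sum>i\<in>?I. A i)"
    unfolding set_sum_alt[OF finite_atLeastAtMost] by blast
  then have "0 \<in> (\<Sum>i\<in>?I. A i) + limiting_normal_cone S xbar"
    using set_plus_intro[OF _ normal] by fastforce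
  moreover have "\<exists>i\<in>?I. l i \<noteq> 0"
    using l(2) sum.neutral[of ?I l] by fastforce
  ultimately show ?thesis
    unfolding stationary_point_def A_def using l(1) by blast
qed

end
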